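(* Let $(X,\mathcal{U})$ be a uniform space. If $f\colon(X,\mathcal{U})\to(X,\mathcal{U})$ is continuous, then $\widehat{f}\colon(\mathcal{F}(X),\mathcal{U}_S)\to(\mathcal{F}(X),\mathcal{U}_S)$ is continuous.
   Context: A uniform space $(X,\mathcal{U})$ is a non-empty set $X$ with a uniformity $\mathcal{U}$ given by entourages of the diagonal, assumed separated: $\bigcap_{U\in\mathcal{U}}U=\Delta_X$. For $U\in\mathcal{U}$, $x\in X$, $A\subseteq X$, put $U(x)=\{y\in X:(x,y)\in U\}$ and $U(A)=\bigcup_{x\in A}U(x)$ (and similarly for any uniform space). The induced topology is $\tau(\mathcal{U})=\{V\subseteq X: \text{for every }x\in V\text{ there is }U\in\mathcal{U}\text{ with }U(x)\subseteq V\}$. Continuity of maps between uniform spaces always means continuity with respect to the induced topologies (not uniform continuity). For a uniform space $Y$, $\mathcal{K}(Y)$ is the set of non-empty compact subsets of $Y$, and for an entourage $U$ of $Y$, $\mathcal{K}[U]=\{(A,B)\in\mathcal{K}(Y)\times\mathcal{K}(Y): A\subseteq U(B),\ B\subseteq U(A)\}$. Let $\mathbb{I}=[0,1]$. A fuzzy set on $X$ is a function $u\colon X\to\mathbb{I}$; its $\alpha$-cut is $u_\alpha=\{x\in X:u(x)\ge\alpha\}$ for $\alpha\in(0,1]$, and its support is $u_0=\overline{\{x\in X:u(x)>0\}}$. $u$ is normal if $u(x)=1$ for some $x$. $\mathcal{F}(X)$ is the set of all normal upper semicontinuous fuzzy sets on $X$ with compact support. Zadeh's extension $\widehat{f}\colon\mathcal{F}(X)\to\mathcal{F}(X)$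 of a continuous $f\colon X\to X$ is $\widehat{f}(u)(x)=\sup\{u(z):z\in f^{-1}(x)\}$ if $f^{-1}(x)\ne\emptyset$, and $\widehat{f}(u)(x)=0$ otherwise. The sendograph of $u\in\mathcal{F}(X)$ is $\mathrm{send}(u)=\{(x,\alpha)\in X\times\mathbb{I}:u(x)\ge\alpha\}\cap(u_0\times\mathbb{I})$, an element of $\mathcal{K}(X\times\mathbb{I})$. Let $V_\epsilon=\{(\alpha,\beta)\in\mathbb{I}\times\mathbb{I}:|\alpha-\beta|<\epsilon\}$, and regard $U\times V_\epsilon$ as the entourage $\{((x,\alpha),(y,\beta)):(x,y)\in U,\ (\alpha,\beta)\in V_\epsilon\}$ of $X\times\mathbb{I}$. The sendograph uniformity $\mathcal{U}_S$ on $\mathcal{F}(X)$ has base $\{S[U,\epsilon]:U\in\mathcal{U},\ \epsilon>0\}$, where $S[U,\epsilon]=\{(u,v)\in\mathcal{F}(X)\times\mathcal{F}(X):(\mathrm{send}(u),\mathrm{send}(v))\in\mathcal{K}[U\times V_\epsilon]\}$ (it is known that this is a base of a uniformity). *)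

theory Defs
  imports "HOL-Analysis.Analysis"
begin

section \<open>Separated uniform spaces\<close>

text \<open>The library class \<^class>\<open>uniform_space\<close> gives the uniformity as a filter on pairs and ties
  \<^term>\<open>open\<close> to it by \<open>open_uniformity\<close>, which is the definition of the induced topology.
  The carrier is the whole type.\<close>

definition (in uniformity) entourages :: "('a \<times> 'a) set set" where
  "entourages = {U. eventually (\<lambda>p. p \<in> U) uniformity}"

class separated_uniform_space = uniform_space +
  assumes separated: "\<Inter>entourages = Id"
begin

subclass t2_space
proof
  fix x y :: 'a
  assume "x \<noteq> y"
  then have "(x, y) \<notin> \<Inter>entourages"
    by (simp add: separated)
  then obtain U where U: "eventually (\<lambda>p. p \<in> U) uniformity" "(x, y) \<notin> U"
    by (auto simp: entourages_def)
  then obtain D where D: "eventually D uniformity"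
    and DD: "\<And>a b c. D (a, b) \<Longrightarrow> D (b, c) \<Longrightarrow> (a, c) \<in> U"
    using uniformity_transE[OF U(1)] by metis
  have "eventually (\<lambda>z. D (x, z)) (nhds x)"
    unfolding eventually_nhds_uniformity
    using D by (rule eventually_mono) auto
  then obtain V where V: "open V" "x \<in> V" "\<And>z. z \<in> V \<Longrightarrow> D (x, z)"
    unfolding eventually_nhds by auto
  have "eventually (\<lambda>z. D (z, y)) (nhds y)"
    unfolding eventually_nhds_uniformity
    using uniformity_sym[OF D] by (rule eventually_mono) auto
  then obtain W where W: "open W" "y \<in> W" "\<And>z. z \<in> W \<Longrightarrow> D (z, y)"
    unfolding eventually_nhds by auto
  have "V \<inter> W = {}"
    using V(3) W(3) DD U(2) by blast
  with V W show "\<exists>U V. open U \<and> open V \<and> x \<in> U \<and> y \<in> V \<and> U \<inter> V = {}"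
    by blast
qed

end

text \<open>The topology induced on a carrier set \<open>A\<close> by a family \<open>\<E>\<close> of entourages of \<open>A\<close>. The constant
  \<^const>\<open>topology\<close> is only meaningful if its argument satisfies \<^const>\<open>istopology\<close>; see
  \<open>istopology_uniform\<close>.\<close>

definition uniform_topology :: "'b set \<Rightarrow> ('b \<times> 'b) set set \<Rightarrow> 'b topology" where
  "uniform_topology A \<E> = topology (\<lambda>V. V \<subseteq> A \<and> (\<forall>x\<in>V. \<exists>E\<in>\<E>. E `` {x} \<subseteq> V))"

lemma istopology_uniform:
  assumes "\<And>E F. E \<in> \<E> \<Longrightarrow> F \<in> \<E> \<Longrightarrow> E \<inter> F \<in> \<E>"
  shows "istopology (\<lambda>V. V \<subseteq> A \<and> (\<forall>x\<in>V. \<exists>E\<in>\<E>. E `` {x} \<subseteq> V))"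
  unfolding istopology_def
proof (intro conjI allI impI)
  fix S T
  assume S: "S \<subseteq> A \<and> (\<forall>x\<in>S. \<exists>E\<in>\<E>. E `` {x} \<subseteq> S)"
    and T: "T \<subseteq> A \<and> (\<forall>x\<in>T. \<exists>E\<in>\<E>. E `` {x} \<subseteq> T)"
  show "S \<inter> T \<subseteq> A" using S by blast
  show "\<forall>x\<in>S \<inter> T. \<exists>E\<in>\<E>. E `` {x} \<subseteq> S \<inter> T"
  proof
    fix x assume "x \<in> S \<inter> T"
    then obtain E F where "E \<in> \<E>" "E `` {x} \<subseteq> S" "F \<in> \<E>" "F `` {x} \<subseteq> T"
      using S T by blast
    then show "\<exists>E\<in>\<E>. E `` {x} \<subseteq> S \<inter> T"
      using assms by (intro bexI[of _ "E \<inter> F"]) auto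
  qed
next
  fix \<K> :: "'a set set"
  assume K: "\<forall>K\<in>\<K>. K \<subseteq> A \<and> (\<forall>x\<in>K. \<exists>E\<in>\<E>. E `` {x} \<subseteq> K)"
  then show "\<Union>\<K> \<subseteq> A" by blast
  show "\<forall>x\<in>\<Union>\<K>. \<exists>E\<in>\<E>. E `` {x} \<subseteq> \<Union>\<K>"
    using K by (meson UnionE Union_upper subset_trans)
qed


section \<open>Hyperspaces\<close>

definition compact_sets :: "'b::topological_space set \<Rightarrow> 'b set set" where
  "compact_sets Y = {A. A \<subseteq> Y \<and> A \<noteq> {} \<and> compact A}"

definition compact_entourage ::
  "'b::topological_space set \<Rightarrow> ('b \<times> 'b) set \<Rightarrow> ('b set \<times> 'b set) set" where
  "compact_entourage Y U =
    {(A, B). A \<in> compact_sets Y \<and> B \<in> compact_sets Y \<and> A \<subseteq> U `` B \<and> B \<subseteq> U `` A}"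


section \<open>Fuzzy sets\<close>

text \<open>Fuzzy sets are real-valued functions; the restriction to values in the unit interval is part
  of \<open>fuzzy_space\<close> below, so the suprema in \<open>zadeh\<close> are over bounded sets.\<close>

definition upper_semicontinuous :: "('a::topological_space \<Rightarrow> real) \<Rightarrow> bool" where
  "upper_semicontinuous u \<longleftrightarrow> (\<forall>x a. u x < a \<longrightarrow> (\<forall>\<^sub>F y in nhds x. u y < a))"

definition fuzzy_support :: "('a::topological_space \<Rightarrow> real) \<Rightarrow> 'a set" where
  "fuzzy_support u = closure {x. u x > 0}"

definition fuzzy_space :: "('a::topological_space \<Rightarrow> real) set" where
  "fuzzy_space = {u. range u \<subseteq> {0..1} \<and> (\<exists>x. u x = 1) \<and> upper_semicontinuous u \<and>
    compact (fuzzy_support u)}"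

definition zadeh :: "('a \<Rightarrow> 'a) \<Rightarrow> ('a \<Rightarrow> real) \<Rightarrow> ('a \<Rightarrow> real)" where
  "zadeh f u = (\<lambda>x. if f -` {x} \<noteq> {} then (SUP z\<in>f -` {x}. u z) else 0)"


section \<open>The sendograph uniformity\<close>

definition send :: "('a::topological_space \<Rightarrow> real) \<Rightarrow> ('a \<times> real) set" where
  "send u = {(x, \<alpha>). \<alpha> \<in> {0..1} \<and> u x \<ge> \<alpha>} \<inter> (fuzzy_support u \<times> {0..1})"

definition unit_entourage :: "real \<Rightarrow> (real \<times> real) set" where
  "unit_entourage \<epsilon> = {(\<alpha>, \<beta>). \<alpha> \<in> {0..1} \<and> \<beta> \<in> {0..1} \<and> \<bar>\<alpha> - \<beta>\<bar> < \<epsilon>}"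

definition prod_entourage ::
  "('a \<times> 'a) set \<Rightarrow> ('b \<times> 'b) set \<Rightarrow> (('a \<times> 'b) \<times> ('a \<times> 'b)) set" where
  "prod_entourage U V = {((x, \<alpha>), (y, \<beta>)). (x, y) \<in> U \<and> (\<alpha>, \<beta>) \<in> V}"

definition send_basic ::
  "('a::topological_space \<times> 'a) set \<Rightarrow> real \<Rightarrow> (('a \<Rightarrow> real) \<times> ('a \<Rightarrow> real)) set" where
  "send_basic U \<epsilon> = {(u, v). u \<in> fuzzy_space \<and> v \<in> fuzzy_space \<and>
    (send u, send v) \<in> compact_entourage (UNIV \<times> {0..1}) (prod_entourage U (unit_entourage \<epsilon>))}"

definition send_uniformity :: "(('a::uniform_space \<Rightarrow> real) \<times> ('a \<Rightarrow> real)) set set" where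
  "send_uniformity = {E. E \<subseteq> fuzzy_space \<times> fuzzy_space \<and>
    (\<exists>U\<in>entourages. \<exists>\<epsilon>>0. send_basic U \<epsilon> \<subseteq> E)}"

definition send_topology :: "('a::uniform_space \<Rightarrow> real) topology" where
  "send_topology = uniform_topology fuzzy_space send_uniformity"

lemma send_basic_mono:
  assumes "U \<subseteq> U'" "\<epsilon> \<le> \<epsilon>'"
  shows "send_basic U \<epsilon> \<subseteq> send_basic U' \<epsilon>'"
proof -
  have "prod_entourage U (unit_entourage \<epsilon>) \<subseteq> prod_entourage U' (unit_entourage \<epsilon>')"
    using assms by (auto simp: prod_entourage_def unit_entourage_def)
  then have "prod_entourage U (unit_entourage \<epsilon>) `` A \<subseteq> prod_entourage U' (unit_entourage \<epsilon>') `` A" for A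
    by blast
  then show ?thesis
    unfolding send_basic_def compact_entourage_def by blast
qed

lemma send_uniformity_Int:
  assumes "E \<in> send_uniformity" "F \<in> send_uniformity"
  shows "E \<inter> F \<in> send_uniformity"
proof -
  obtain U \<epsilon> where U: "U \<in> entourages" "\<epsilon> > 0" "send_basic U \<epsilon> \<subseteq> E"
    using assms(1) by (auto simp: send_uniformity_def)
  obtain V \<delta> where V: "V \<in> entourages" "\<delta> > 0" "send_basic V \<delta> \<subseteq> F"
    using assms(2) by (auto simp: send_uniformity_def)
  have "U \<inter> V \<in> entourages"
    using U V by (auto simp: entourages_def eventually_conj_iff)
  moreover have "send_basic (U \<inter> V) (min \<epsilon> \<delta>) \<subseteq> E \<inter> F"
    using send_basic_mono[of "U \<inter> V" U "min \<epsilon> \<delta>" \<epsilon>] send_basic_mono[of "U \<inter> V" V "min \<epsilon> \<delta>" \<delta>]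
      U(3) V(3) by auto
  moreover have "min \<epsilon> \<delta> > 0"
    using U V by simp
  ultimately show ?thesis
    using assms unfolding send_uniformity_def by blast
qed

lemma openin_send_topology:
  "openin send_topology V \<longleftrightarrow>
    V \<subseteq> (fuzzy_space :: ('a::uniform_space \<Rightarrow> real) set) \<and>
    (\<forall>u\<in>V. \<exists>E\<in>send_uniformity. E `` {u} \<subseteq> V)"
proof -
  have "istopology (\<lambda>V :: ('a \<Rightarrow> real) set. V \<subseteq> fuzzy_space \<and>
      (\<forall>u\<in>V. \<exists>E\<in>send_uniformity. E `` {u} \<subseteq> V))"
    by (rule istopology_uniform) (rule send_uniformity_Int)
  then show ?thesis
    unfolding send_topology_def uniform_topology_def by (simp only: topology_inverse')
qed

lemma topspace_send_topology:
  "topspace send_topology = (fuzzy_space :: ('a::uniform_space \<Rightarrow> real) set)"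
proof -
  have "UNIV \<in> (entourages :: ('a \<times> 'a) set set)"
    by (simp add: entourages_def)
  then have "fuzzy_space \<times> fuzzy_space \<in> (send_uniformity :: (('a \<Rightarrow> real) \<times> ('a \<Rightarrow> real)) set set)"
  proof -
    have "send_basic UNIV 1 \<subseteq> fuzzy_space \<times> (fuzzy_space :: ('a \<Rightarrow> real) set)"
      unfolding send_basic_def by blast
    then show ?thesis
      using \<open>UNIV \<in> entourages\<close> zero_less_one unfolding send_uniformity_def by blast
  qed
  then have "openin send_topology (fuzzy_space :: ('a \<Rightarrow> real) set)"
    unfolding openin_send_topology by (intro conjI ballI bexI[rotated]) auto
  then have "(fuzzy_space :: ('a \<Rightarrow> real) set) \<subseteq> topspace send_topology"
    by (rule openin_subset)
  moreover have "topspace send_topology \<subseteq> (fuzzy_space :: ('a \<Rightarrow> real) set)"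
    using openin_topspace[of send_topology] unfolding openin_send_topology by (rule conjunct1)
  ultimately show ?thesis
    by (rule subset_antisym[rotated])
qed

text \<open>The membership conditions of \<^const>\<open>compact_entourage\<close> hold for all sendographs.\<close>

lemma send_in_compact_sets:
  fixes u :: "'a::topological_space \<Rightarrow> real"
  assumes "u \<in> fuzzy_space"
  shows "send u \<in> compact_sets (UNIV \<times> {0..1})"
proof -
  have usc: "upper_semicontinuous u" and cpt: "compact (fuzzy_support u)"
    using assms by (auto simp: fuzzy_space_def)
  obtain x where x: "u x = 1"
    using assms by (auto simp: fuzzy_space_def)
  have "x \<in> fuzzy_support u"
    unfolding fuzzy_support_def using x by (intro closure_subset[THEN subsetD]) simp
  with x have ne: "(x, 1) \<in> send u"
    by (simp add: send_def)
  have "open {(x, \<alpha>). u x < \<alpha>}"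
  proof (subst open_prod_def, safe)
    fix x \<alpha>
    assume "u x < \<alpha>"
    then obtain c where c: "u x < c" "c < \<alpha>"
      using dense by blast
    obtain S where S: "open S" "x \<in> S" "\<And>y. y \<in> S \<Longrightarrow> u y < c"
      using usc c(1) unfolding upper_semicontinuous_def eventually_nhds by meson
    have "S \<times> {c<..} \<subseteq> {(x, \<alpha>). u x < \<alpha>}"
      using S(3) by fastforce
    then show "\<exists>A B. open A \<and> open B \<and> (x, \<alpha>) \<in> A \<times> B \<and> A \<times> B \<subseteq> {(x, \<alpha>). u x < \<alpha>}"
      using S c by (intro exI[of _ S] exI[of _ "{c<..}"]) auto
  qed
  then have "closed (- {(x, \<alpha>). u x < \<alpha>})"
    by (simp add: closed_Compl)
  then have "compact ((fuzzy_support u \<times> {0..1}) \<inter> - {(x, \<alpha>). u x < \<alpha>})"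
    by (intro compact_Int_closed compact_Times cpt compact_Icc)
  moreover have "send u = (fuzzy_support u \<times> {0..1}) \<inter> - {(x, \<alpha>). u x < \<alpha>}"
    by (auto simp: send_def)
  ultimately have "compact (send u)"
    by simp
  moreover have "send u \<subseteq> UNIV \<times> {0..1}"
    by (auto simp: send_def)
  ultimately show ?thesis
    using ne unfolding compact_sets_def by blast
qed

end

theory Submission
  imports Defs
begin

text \<open>Suprema over fibres are attained at positive levels by compactness, so the sendograph of the
  Zadeh extension is the image of the sendograph under \<open>f \<times> id\<close>. Although \<open>f\<close> need not be uniformly
  continuous, it is so at the points of the compact support of \<open>u\<close>, with the second
  point ranging over the whole space. As one sendograph in a basic entourage is kept fixed, this
  suffices to move a basic entourage through \<open>f \<times> id\<close>.\<close>

section \<open>Uniform control of a continuous map along a compact set\<close>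

lemma (in uniform_space) eventually_uniformity_symmetrize:
  assumes "eventually P uniformity"
  shows "\<forall>\<^sub>F p in uniformity. P p \<and> P (snd p, fst p)"
  using assms uniformity_sym[OF assms] by (simp add: eventually_conj_iff case_prod_unfold)

text \<open>A Heine-Cantor argument: finitely many neighbourhoods \<open>N x\<close> with centres in
  \<open>K\<close> cover \<open>K\<close>, and the intersection of the matching entourages
  \<open>E x\<close> works. Only the first point is placed in a neighbourhood; the second is reached
  from it by one more \<open>E x\<close> step, so it may lie outside \<open>K\<close>.\<close>

lemma uniformity_compact_continuous:
  fixes f :: "'a::uniform_space \<Rightarrow> 'b::uniform_space"
  assumes f: "continuous_on UNIV f" and K: "compact K"
    and U: "eventually U uniformity"
  shows "\<forall>\<^sub>F p in uniformity. fst p \<in> K \<longrightarrow> U (f (fst p), f (snd p))"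
proof -
  obtain V where V: "eventually V uniformity" "\<And>x y. V (x, y) \<Longrightarrow> V (y, x)"
    "\<And>x y z. V (x, y) \<Longrightarrow> V (y, z) \<Longrightarrow> U (x, z)"
  proof -
    obtain W where W: "eventually W uniformity" "\<And>x y z. W (x, y) \<Longrightarrow> W (y, z) \<Longrightarrow> U (x, z)"
      using uniformity_transE[OF U] by metis
    show ?thesis
      by (rule that[OF eventually_uniformity_symmetrize[OF W(1)]]) (use W(2) in auto)
  qed
  \<comment> \<open>\<open>E\<close> is a half of the entourage expressing continuity at
    \<open>x\<close>: two \<open>E\<close> steps from \<open>x\<close> end where \<open>f\<close> is
    still \<open>V\<close>-close to \<open>f x\<close>.\<close>
  have "\<exists>E. eventually E uniformity \<and>
      (\<forall>y z. E (x, y) \<longrightarrow> E (y, z) \<longrightarrow> V (f x, f z))" for x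
  proof -
    have "eventually (\<lambda>b. V (f x, b)) (nhds (f x))"
      unfolding eventually_nhds_uniformity using V(1) by (rule eventually_mono) auto
    moreover have "filterlim f (nhds (f x)) (nhds x)"
      using f unfolding tendsto_at_iff_tendsto_nhds[symmetric] continuous_on_def by simp
    ultimately have "eventually (\<lambda>y. V (f x, f y)) (nhds x)"
      by (auto dest: filterlim_iff[THEN iffD1])
    then have "eventually (\<lambda>(x', y). x' = x \<longrightarrow> V (f x, f y)) uniformity"
      by (simp add: eventually_nhds_uniformity)
    from uniformity_transE[OF this] show ?thesis
      by (metis (mono_tags, lifting) case_prod_conv)
  qed
  then obtain E where E: "\<And>x. eventually (E x) uniformity"
    "\<And>x y z. E x (x, y) \<Longrightarrow> E x (y, z) \<Longrightarrow> V (f x, f z)"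
    by metis
  have "\<exists>N. open N \<and> x \<in> N \<and> (\<forall>y\<in>N. E x (x, y))" for x
  proof -
    have "eventually (\<lambda>y. E x (x, y)) (nhds x)"
      unfolding eventually_nhds_uniformity using E(1)[of x] by (rule eventually_mono) auto
    then show ?thesis
      by (auto simp: eventually_nhds)
  qed
  then obtain N where N: "\<And>x. open (N x)" "\<And>x. x \<in> N x" "\<And>x y. y \<in> N x \<Longrightarrow> E x (x, y)"
    by metis
  obtain C where C: "C \<subseteq> K" "finite C" "K \<subseteq> (\<Union>x\<in>C. N x)"
    using compactE_image[OF K, of K N] N(1,2) by blast
  have "\<forall>\<^sub>F p in uniformity. \<forall>x\<in>C. E x p"
    using C(2) E(1) by (simp add: eventually_ball_finite)
  then show ?thesis
  proof (rule eventually_mono, intro impI)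
    fix p assume p: "\<forall>x\<in>C. E x p" "fst p \<in> K"
    obtain x where x: "x \<in> C" "fst p \<in> N x"
      using C(3) p(2) by blast
    have 1: "V (f x, f (snd p))"
      using E(2)[OF N(3)[OF x(2)]] p(1) x(1) by simp
    \<comment> \<open>The diagonal pair serves as a trivial second step, so that
      \<open>fst p\<close> itself, like \<open>snd p\<close>, has its image \<open>V\<close>-close
      to \<open>f x\<close>.\<close>
    have "E x (fst p, fst p)"
      using uniformity_refl[OF E(1)] by simp
    then have "V (f x, f (fst p))"
      using E(2)[OF N(3)[OF x(2)]] by blast
    with 1 show "U (f (fst p), f (snd p))"
      using V(2,3) by blast
  qed
qed

section \<open>Cuts of upper semicontinuous fuzzy sets\<close>

lemma upper_semicontinuous_iff_closed:
  "upper_semicontinuous u \<longleftrightarrow> (\<forall>a. closed {x. a \<le> u x})"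
proof -
  have "open {x. u x < a} \<longleftrightarrow> (\<forall>x. u x < a \<longrightarrow> (\<forall>\<^sub>F y in nhds x. u y < a))" for a
    by (subst open_subopen) (simp add: eventually_nhds subset_iff Ball_def)
  then have "upper_semicontinuous u \<longleftrightarrow> (\<forall>a. open {x. u x < a})"
    unfolding upper_semicontinuous_def by blast
  moreover have "{x. u x < a} = - {x. a \<le> u x}" for a
    by auto
  ultimately show ?thesis
    by (simp add: closed_def)
qed

lemma fuzzy_supportI: "0 < u x \<Longrightarrow> x \<in> fuzzy_support u"
  unfolding fuzzy_support_def by (intro closure_subset[THEN subsetD]) simp

lemma fuzzy_spaceD:
  assumes "u \<in> fuzzy_space"
  shows "0 \<le> u x" "u x \<le> 1" "upper_semicontinuous u" "compact (fuzzy_support u)" "\<exists>x. u x = 1"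
  using assms by (auto simp: fuzzy_space_def image_subset_iff)

text \<open>A cut at a positive level is a closed subset of the compact support; at level 0 or below
  it would be the whole space.\<close>

lemma compact_cut:
  assumes "u \<in> fuzzy_space" "0 < a"
  shows "compact {x. a \<le> u x}"
proof -
  have "{x. a \<le> u x} = fuzzy_support u \<inter> {x. a \<le> u x}"
    using assms(2) by (auto intro: fuzzy_supportI)
  then show ?thesis
    using fuzzy_spaceD(3,4)[OF assms(1)] upper_semicontinuous_iff_closed compact_Int_closed
    by metis
qed

section \<open>Suprema over fibres\<close>

lemma zadeh_upper:
  assumes "u \<in> fuzzy_space"
  shows "u z \<le> zadeh f u (f z)"
proof -
  have "bdd_above (u ` (f -` {f z}))"
    using fuzzy_spaceD(2)[OF assms] by (auto intro!: bdd_aboveI2)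
  then show ?thesis
    by (auto simp: zadeh_def intro: cSUP_upper)
qed

text \<open>The bound \<open>0 \<le> c\<close> covers the empty fibre, where the extension has the
  default value 0.\<close>

lemma zadeh_least:
  assumes "\<And>z. f z = x \<Longrightarrow> u z \<le> c" "0 \<le> c"
  shows "zadeh f u x \<le> c"
  using assms by (auto simp: zadeh_def intro!: cSUP_least)

text \<open>The supremum is attained at positive levels. If \<open>u\<close> stayed below
  \<open>a\<close> on the fibre, the open sets where \<open>u\<close> is below some
  \<open>c < a\<close> would cover the compact part of the fibre in the support, and a finite
  subcover would bound the supremum strictly below \<open>a\<close>.\<close>

lemma zadeh_ge_iff:
  fixes f :: "'a::topological_space \<Rightarrow> 'a"
  assumes f: "continuous_on UNIV f" and u: "u \<in> fuzzy_space" and a: "0 < a"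
    and x: "closed {x}"
  shows "a \<le> zadeh f u x \<longleftrightarrow> (\<exists>z. f z = x \<and> a \<le> u z)"
proof
  assume le: "a \<le> zadeh f u x"
  show "\<exists>z. f z = x \<and> a \<le> u z"
  proof (rule ccontr)
    assume "\<nexists>z. f z = x \<and> a \<le> u z"
    then have lt: "u z < a" if "f z = x" for z
      using that by force
    have "compact (fuzzy_support u \<inter> f -` {x})"
      using fuzzy_spaceD(4)[OF u] closed_vimage[OF x f] by (rule compact_Int_closed)
    moreover have "open {z. u z < c}" for c
    proof -
      have "{z. u z < c} = - {z. c \<le> u z}"
        by auto
      then show ?thesis
        using fuzzy_spaceD(3)[OF u] by (simp add: upper_semicontinuous_iff_closed open_Compl)
    qed
    moreover have "fuzzy_support u \<inter> f -` {x} \<subseteq> (\<Union>c\<in>{..<a}. {z. u z < c})"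
      using lt dense by fastforce
    ultimately obtain C where C: "C \<subseteq> {..<a}" "finite C"
      "fuzzy_support u \<inter> f -` {x} \<subseteq> (\<Union>c\<in>C. {z. u z < c})"
      using compactE_image[of "fuzzy_support u \<inter> f -` {x}" "{..<a}" "\<lambda>c. {z. u z < c}"] by metis
    \<comment> \<open>Inserting 0 keeps the maximum meaningful for empty \<open>C\<close>, bounds
      \<open>u\<close> at fibre points where it vanishes, and supplies the nonnegativity that
      \<open>zadeh_least\<close> asks for.\<close>
    define m where "m = Max (insert 0 C)"
    have m: "0 \<le> m" "\<And>c. c \<in> C \<Longrightarrow> c \<le> m" "m < a"
      using C(1,2) a by (auto simp: m_def)
    have "u z \<le> m" if "f z = x" for z
    proof (cases "0 < u z")
      case True
      then have "z \<in> fuzzy_support u \<inter> f -` {x}"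
        using that by (simp add: fuzzy_supportI)
      then show ?thesis
        using C(3) m(2) by fastforce
    qed (use m(1) in simp)
    then have "zadeh f u x \<le> m"
      using m(1) by (rule zadeh_least)
    with le m(3) show False
      by simp
  qed
next
  assume "\<exists>z. f z = x \<and> a \<le> u z"
  then show "a \<le> zadeh f u x"
    using zadeh_upper[OF u, of _ f] order_trans by blast
qed

section \<open>Zadeh's extension on cuts, supports and sendographs\<close>

context
  fixes f :: "'a::t2_space \<Rightarrow> 'a" and u :: "'a \<Rightarrow> real"
  assumes f: "continuous_on UNIV f" and u: "u \<in> fuzzy_space"
begin

lemma zadeh_cut: "0 < a \<Longrightarrow> {x. a \<le> zadeh f u x} = f ` {z. a \<le> u z}"
  using zadeh_ge_iff[OF f u] by auto

lemma zadeh_nonneg: "0 \<le> zadeh f u x"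
proof (cases "f -` {x} = {}")
  case False
  then obtain z where "f z = x"
    by auto
  then show ?thesis
    using zadeh_upper[OF u, of z f] fuzzy_spaceD(1)[OF u, of z] by simp
qed (simp add: zadeh_def)

text \<open>Attainment identifies the sets of positivity. Taking closures then commutes with
  \<open>f\<close>, since the image of the compact support is compact and hence closed in a
  Hausdorff space.\<close>

lemma fuzzy_support_zadeh: "fuzzy_support (zadeh f u) = f ` fuzzy_support u"
proof -
  have pos: "{x. 0 < zadeh f u x} = f ` {z. 0 < u z}"
  proof (intro equalityI subsetI)
    fix x assume "x \<in> {x. 0 < zadeh f u x}"
    then show "x \<in> f ` {z. 0 < u z}"
      \<comment> \<open>The level is the positive value of the extension itself.\<close>
      using zadeh_ge_iff[OF f u, of "zadeh f u x" x] by force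
  next
    fix x assume "x \<in> f ` {z. 0 < u z}"
    then show "x \<in> {x. 0 < zadeh f u x}"
      using zadeh_upper[OF u, of _ f] by (auto intro: less_le_trans)
  qed
  have "compact (f ` fuzzy_support u)"
    using f fuzzy_spaceD(4)[OF u] compact_continuous_image continuous_on_subset by blast
  then have "closure (f ` {z. 0 < u z}) \<subseteq> f ` fuzzy_support u"
    by (intro closure_minimal compact_imp_closed) (auto simp: fuzzy_supportI)
  moreover have "f ` fuzzy_support u \<subseteq> closure (f ` {z. 0 < u z})"
    unfolding fuzzy_support_def
    by (rule image_closure_subset[OF continuous_on_subset[OF f]]) (simp_all add: closure_subset)
  ultimately show ?thesis
    unfolding fuzzy_support_def[of "zadeh f u"] pos by blast
qed

text \<open>Upper semicontinuity is read off from closed cuts: those at positive levels are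
  continuous images of compact cuts, and all others are the whole space.\<close>

lemma zadeh_in_fuzzy_space: "zadeh f u \<in> fuzzy_space"
proof -
  have le1: "zadeh f u x \<le> 1" for x
    using fuzzy_spaceD(2)[OF u] by (intro zadeh_least) auto
  obtain z where "u z = 1"
    using fuzzy_spaceD(5)[OF u] by blast
  then have "zadeh f u (f z) = 1"
    using zadeh_upper[OF u, of z f] le1[of "f z"] by simp
  moreover have "closed {x. a \<le> zadeh f u x}" for a
  proof (cases "0 < a")
    case True
    then show ?thesis
      using compact_continuous_image[OF continuous_on_subset[OF f] compact_cut[OF u True]]
      by (simp add: zadeh_cut compact_imp_closed)
  next
    case False
    then have "{x. a \<le> zadeh f u x} = UNIV"
      using order_trans[OF _ zadeh_nonneg, of a] by auto
    then show ?thesis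
      by simp
  qed
  moreover have "compact (fuzzy_support (zadeh f u))"
    unfolding fuzzy_support_zadeh
    using f fuzzy_spaceD(4)[OF u] compact_continuous_image continuous_on_subset by blast
  ultimately show ?thesis
    using le1 zadeh_nonneg
    by (auto simp: fuzzy_space_def upper_semicontinuous_iff_closed)
qed

lemma send_zadeh: "send (zadeh f u) = map_prod f id ` send u"
proof (intro equalityI subsetI)
  fix p assume p: "p \<in> send (zadeh f u)"
  obtain x a where [simp]: "p = (x, a)"
    by (cases p)
  have a: "0 \<le> a" "a \<le> 1" "a \<le> zadeh f u x" "x \<in> f ` fuzzy_support u"
    using p by (auto simp: send_def fuzzy_support_zadeh)
  have "\<exists>z. f z = x \<and> a \<le> u z \<and> z \<in> fuzzy_support u"
  \<comment> \<open>At level 0 the supremum need not be attained; the preimage comes from the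
    description of the support instead.\<close>
  proof (cases "a = 0")
    case True
    then show ?thesis
      using a(4) fuzzy_spaceD(1)[OF u] by auto
  next
    case False
    then have "0 < a"
      using a(1) by simp
    then obtain z where z: "f z = x" "a \<le> u z"
      using a(3) zadeh_ge_iff[OF f u, of a x] by auto
    then show ?thesis
      using fuzzy_supportI[of u z] \<open>0 < a\<close> by auto
  qed
  then obtain z where "(z, a) \<in> send u" "f z = x"
    using a(1,2) by (auto simp: send_def)
  then show "p \<in> map_prod f id ` send u"
    by force
next
  fix p assume "p \<in> map_prod f id ` send u"
  then obtain z a where "p = (f z, a)" "(z, a) \<in> send u"
    by auto
  then show "p \<in> send (zadeh f u)"
    using zadeh_upper[OF u, of z f] by (auto simp: send_def fuzzy_support_zadeh)
qed

end

section \<open>Continuity for the sendograph uniformity\<close>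

lemma send_basic_iff:
  "(u, v) \<in> send_basic U \<epsilon> \<longleftrightarrow> u \<in> fuzzy_space \<and> v \<in> fuzzy_space \<and>
    send u \<subseteq> prod_entourage U (unit_entourage \<epsilon>) `` send v \<and>
    send v \<subseteq> prod_entourage U (unit_entourage \<epsilon>) `` send u"
  using send_in_compact_sets[of u] send_in_compact_sets[of v]
  by (auto simp: send_basic_def compact_entourage_def)

text \<open>Every pair of points matched between the two sendographs has a member in
  \<open>send u\<close>, so control of \<open>f\<close> at the support of \<open>u\<close> suffices.
  That member may be either coordinate of the pair in \<open>D\<close>, hence the two orientations
  in the assumption. Levels are left alone by \<open>f\<close>, so \<epsilon> is preserved.\<close>

lemma zadeh_send_basic:
  fixes f :: "'a::{uniform_space,t2_space} \<Rightarrow> 'a"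
  assumes f: "continuous_on UNIV f"
    and D: "\<And>x y. x \<in> fuzzy_support u \<Longrightarrow> (x, y) \<in> D \<or> (y, x) \<in> D
      \<Longrightarrow> (f x, f y) \<in> U \<and> (f y, f x) \<in> U"
    and uv: "(u, v) \<in> send_basic D \<epsilon>"
  shows "(zadeh f u, zadeh f v) \<in> send_basic U \<epsilon>"
proof -
  let ?D = "prod_entourage D (unit_entourage \<epsilon>)" and ?U = "prod_entourage U (unit_entourage \<epsilon>)"
  let ?g = "map_prod f id :: 'a \<times> real \<Rightarrow> 'a \<times> real"
  have u: "u \<in> fuzzy_space" and v: "v \<in> fuzzy_space"
    and 1: "send u \<subseteq> ?D `` send v" and 2: "send v \<subseteq> ?D `` send u"
    using uv by (auto simp: send_basic_iff)
  have D': "(?g p, ?g q) \<in> ?U \<and> (?g q, ?g p) \<in> ?U"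
    if "p \<in> send u" "(p, q) \<in> ?D \<or> (q, p) \<in> ?D" for p q
    using that D[of "fst p" "fst q"]
    by (auto simp: prod_entourage_def unit_entourage_def send_def abs_minus_commute)
  have "?g p \<in> ?U `` (?g ` send v)" if p: "p \<in> send u" for p
  proof -
    obtain q where "q \<in> send v" "(q, p) \<in> ?D"
      using 1 p by blast
    then show ?thesis
      using D'[OF p, of q] by (intro ImageI[of "?g q"]) simp_all
  qed
  moreover have "?g q \<in> ?U `` (?g ` send u)" if q: "q \<in> send v" for q
  proof -
    obtain p where "p \<in> send u" "(p, q) \<in> ?D"
      using 2 q by blast
    then show ?thesis
      using D'[of p q] by (intro ImageI[of "?g p"]) simp_all
  qed
  ultimately have "?g ` send u \<subseteq> ?U `` (?g ` send v)" "?g ` send v \<subseteq> ?U `` (?g ` send u)"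
    by (simp_all only: image_subset_iff Ball_def) simp_all
  then show ?thesis
    by (simp add: send_basic_iff send_zadeh[OF f] zadeh_in_fuzzy_space[OF f] u v)
qed

text \<open>Continuity at the single point \<open>u\<close>: \<open>D\<close> depends on the compact
  support of \<open>u\<close>, but not on \<open>v\<close> or \<epsilon>.\<close>

lemma zadeh_continuous_at:
  fixes f :: "'a::{uniform_space,t2_space} \<Rightarrow> 'a"
  assumes f: "continuous_on UNIV f" and u: "u \<in> fuzzy_space" and U: "U \<in> entourages"
  obtains D where "D \<in> entourages"
    "\<And>v \<epsilon>. (u, v) \<in> send_basic D \<epsilon> \<Longrightarrow> (zadeh f u, zadeh f v) \<in> send_basic U \<epsilon>"
proof -
  define P where "P p \<longleftrightarrow> p \<in> U \<and> (snd p, fst p) \<in> U" for p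
  have "eventually (\<lambda>p. p \<in> U) uniformity"
    using U by (simp add: entourages_def)
  then have "eventually P uniformity"
    unfolding P_def by (rule eventually_uniformity_symmetrize)
  from uniformity_compact_continuous[OF f fuzzy_spaceD(4)[OF u] this]
  have ev: "\<forall>\<^sub>F p in uniformity. fst p \<in> fuzzy_support u \<longrightarrow> P (f (fst p), f (snd p))" (is "eventually ?Q _") .
  \<comment> \<open>Both \<open>P\<close> and \<open>D\<close> are symmetrized, which gives the two
    orientations on the side of \<open>U\<close> and on the side of \<open>D\<close>.\<close>
  define D where "D = {p. ?Q p \<and> ?Q (snd p, fst p)}"
  have "D \<in> entourages"
    using eventually_uniformity_symmetrize[OF ev] by (simp add: D_def entourages_def)
  moreover have "(zadeh f u, zadeh f v) \<in> send_basic U \<epsilon>" if "(u, v) \<in> send_basic D \<epsilon>" for v \<epsilon>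
    using f _ that by (rule zadeh_send_basic) (auto simp: D_def P_def)
  ultimately show thesis
    by (rule that)
qed

theorem theorem2p19:
  fixes f :: "'a::separated_uniform_space \<Rightarrow> 'a"
  assumes "continuous_on UNIV f"
  shows "continuous_map send_topology send_topology (zadeh f)"
  unfolding continuous_map_def topspace_send_topology
proof (intro conjI allI impI)
  show "zadeh f \<in> fuzzy_space \<rightarrow> fuzzy_space"
    using zadeh_in_fuzzy_space[OF assms] by blast
next
  fix W :: "('a \<Rightarrow> real) set"
  assume W: "openin send_topology W"
  show "openin send_topology {u \<in> fuzzy_space. zadeh f u \<in> W}"
    unfolding openin_send_topology
  proof (intro conjI ballI)
    fix u assume "u \<in> {u \<in> fuzzy_space. zadeh f u \<in> W}"
    then have u: "u \<in> fuzzy_space" "zadeh f u \<in> W"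
      by auto
    then obtain E where "E \<in> send_uniformity" "E `` {zadeh f u} \<subseteq> W"
      using W unfolding openin_send_topology by blast
    then obtain U \<epsilon> where U: "U \<in> entourages" "\<epsilon> > 0" "send_basic U \<epsilon> `` {zadeh f u} \<subseteq> W"
      unfolding send_uniformity_def by blast
    obtain D where D: "D \<in> entourages"
      "\<And>v \<epsilon>. (u, v) \<in> send_basic D \<epsilon> \<Longrightarrow> (zadeh f u, zadeh f v) \<in> send_basic U \<epsilon>"
      using zadeh_continuous_at[OF assms u(1) U(1)] by blast
    have "send_basic D \<epsilon> \<subseteq> fuzzy_space \<times> fuzzy_space"
      unfolding send_basic_def by blast
    then have "send_basic D \<epsilon> \<in> send_uniformity"
      using D(1) U(2) unfolding send_uniformity_def by blast
    moreover have "send_basic D \<epsilon> `` {u} \<subseteq> {u \<in> fuzzy_space. zadeh f u \<in> W}"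
      using D(2) U(3) unfolding send_basic_iff by (fastforce simp: send_basic_iff)
    ultimately show "\<exists>E\<in>send_uniformity. E `` {u} \<subseteq> {u \<in> fuzzy_space. zadeh f u \<in> W}"
      by blast
  qed blast
qed

end
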